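(* Let $X$ be a real vector space equipped with a complete and invariant metric ${\bf d}$ such that ${\bf d}(\lambda x,\lambda y)\le \lambda\,{\bf d}(x,y)$ for all $\lambda\in[0,1)$ and all $x,y\in X$. Let $F:[a,b]\to X$ be differentiable on $[a,b]$. If $F'$ is continuous on $[a,b]$, then $$\int_a^{\tau}F'(s)\,ds=F(\tau)-F(a)\qquad\text{for all }\tau\in[a,b].$$
   Context: The metric ${\bf d}$ on $X$ is invariant if ${\bf d}(x+z,y+z)={\bf d}(x,y)$ for all $x,y,z\in X$, and complete if every Cauchy sequence converges in $X$. A tagged partition of $[a,b]$ is $\Delta=\{(s_i,[t_{i-1},t_i]):1\le i\le N\}$ with $a=t_0<t_1<\dots<t_N=b$ and tags $s_i\in[t_{i-1},t_i]$; write $|\Delta|:=\max_{1\le i\le N}(t_i-t_{i-1})$ and $f(\Delta):=\sum_{i=1}^N(t_i-t_{i-1})f(s_i)$. A function $f:[a,b]\to X$ is Riemann integrable on $[a,b]$ if there is $\bar x\in X$ such that for every $\varepsilon>0$ there is $\delta>0$ with ${\bf d}(f(\Delta),\bar x)<\varepsilon$ for every tagged partition $\Delta$ of $[a,b]$ with $|\Delta|<\delta$; then $\bar x$ is denoted $\int_a^b f(t)\,dt$. The integral $\int_a^\tau$ is that of the restriction to $[a,\tau]$ (and is $0$ for $\tau=a$); the asserted identity includes the existence of the Riemann integral. A function $\varphi:[a,b]\to X$ is differentiable at $t\in[a,b]$ with derivative $\varphi'(t)=x_t\in X$ if ${\bf d}(0,\varphi(t+s)-\varphi(t)-s x_t)=o(s)$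 as $s\to0$ with $t+s\in[a,b]$. *)

theory Defs
  imports "HOL-Analysis.Analysis" "HOL-Library.Landau_Symbols"
begin

(* The codomain is only a real vector space with a metric: it is not an instance of
   real_normed_vector, so the library's vector derivative and integral do not apply. *)

(* The partition a = t 0 < ... < t N = b with tags s 1, ..., s N; values of t and s at
   other indices are irrelevant. *)
definition tagged_part ::
    "real \<Rightarrow> real \<Rightarrow> nat \<Rightarrow> (nat \<Rightarrow> real) \<Rightarrow> (nat \<Rightarrow> real) \<Rightarrow> bool" where
  "tagged_part a b N t s \<longleftrightarrow>
     1 \<le> N \<and> t 0 = a \<and> t N = b \<and>
     (\<forall>i\<in>{1..N}. t (i - 1) < t i \<and> s i \<in> {t (i - 1)..t i})"

definition mesh :: "nat \<Rightarrow> (nat \<Rightarrow> real) \<Rightarrow> real" where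
  "mesh N t = Max ((\<lambda>i. t i - t (i - 1)) ` {1..N})"

definition riemann_sum ::
    "(real \<Rightarrow> 'a::real_vector) \<Rightarrow> nat \<Rightarrow> (nat \<Rightarrow> real) \<Rightarrow> (nat \<Rightarrow> real) \<Rightarrow> 'a" where
  "riemann_sum f N t s = (\<Sum>i=1..N. (t i - t (i - 1)) *\<^sub>R f (s i))"

(* Over a degenerate interval, which has no tagged partitions, the integral is 0 by
   convention. *)
definition has_riemann_integral ::
    "(real \<Rightarrow> 'a::{real_vector, metric_space}) \<Rightarrow> real \<Rightarrow> real \<Rightarrow> 'a \<Rightarrow> bool" where
  "has_riemann_integral f a b x \<longleftrightarrow>
     a = b \<and> x = 0 \<or>
     a < b \<and> (\<forall>\<epsilon>>0. \<exists>\<delta>>0. \<forall>N t s. tagged_part a b N t s \<longrightarrow> mesh N t < \<delta> \<longrightarrow>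
                 dist (riemann_sum f N t s) x < \<epsilon>)"

definition riemann_integrable ::
    "(real \<Rightarrow> 'a::{real_vector, metric_space}) \<Rightarrow> real \<Rightarrow> real \<Rightarrow> bool" where
  "riemann_integrable f a b \<longleftrightarrow> (\<exists>x. has_riemann_integral f a b x)"

definition riemann_integral ::
    "(real \<Rightarrow> 'a::{real_vector, metric_space}) \<Rightarrow> real \<Rightarrow> real \<Rightarrow> 'a" where
  "riemann_integral f a b = (THE x. has_riemann_integral f a b x)"

definition has_metric_derivative ::
    "(real \<Rightarrow> 'a::{real_vector, metric_space}) \<Rightarrow> 'a \<Rightarrow> real \<Rightarrow> real set \<Rightarrow> bool" where
  "has_metric_derivative \<phi> x t S \<longleftrightarrow>
     (\<lambda>s. dist 0 (\<phi> (t + s) - \<phi> t - s *\<^sub>R x)) \<in> o[at 0 within {s. t + s \<in> S}](\<lambda>s. s)"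

end

theory Submission
  imports Defs
begin

text \<open>The hypotheses force \<open>dist 0\<close> to be positively homogeneous, since
  \<open>dist 0 x \<le> dist 0 (l *\<^sub>R x) + dist 0 ((1 - l) *\<^sub>R x) \<le> l * dist 0 x + (1 - l) * dist 0 x\<close>
  for \<open>0 < l < 1\<close>. Hence the classical Banach space argument applies: a bisection argument gives
  the mean value inequality, which bounds the contribution of each subinterval of a
  partition by its length times the oscillation of the derivative.\<close>

section \<open>Differentiability in epsilon-delta form\<close>

lemma has_metric_derivativeD:
  assumes "has_metric_derivative F y x S" and "\<eta> > 0"
  obtains r where "r > 0"
    and "\<And>v. v \<in> S \<Longrightarrow> \<bar>v - x\<bar> < r \<Longrightarrow> dist 0 (F v - F x - (v - x) *\<^sub>R y) \<le> \<eta> * \<bar>v - x\<bar>"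
proof -
  have "\<forall>\<^sub>F s in at 0 within {s. x + s \<in> S}.
      norm (dist 0 (F (x + s) - F x - s *\<^sub>R y)) \<le> \<eta> * norm s"
    using assms unfolding has_metric_derivative_def by (rule landau_o.smallD)
  then obtain r where "r > 0" and r: "\<And>s. x + s \<in> S \<Longrightarrow> s \<noteq> 0 \<Longrightarrow> dist s 0 < r \<Longrightarrow>
      dist 0 (F (x + s) - F x - s *\<^sub>R y) \<le> \<eta> * \<bar>s\<bar>"
    unfolding eventually_at by auto
  \<comment> \<open>The filter at 0 is punctured, so \<open>r\<close> gives nothing at
    \<open>v = x\<close>; there both sides vanish.\<close>
  have "dist 0 (F v - F x - (v - x) *\<^sub>R y) \<le> \<eta> * \<bar>v - x\<bar>" if "v \<in> S" "\<bar>v - x\<bar> < r" for v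
    using r[of "v - x"] that by (cases "v = x") (auto simp: dist_real_def)
  with \<open>r > 0\<close> show ?thesis by (rule that)
qed

section \<open>Tagged partitions and uniqueness of the integral\<close>

lemma uniform_tagged_part:
  fixes a b :: real
  assumes "a < b" and "1 \<le> N"
  defines "t \<equiv> \<lambda>i. a + real i * ((b - a) / real N)"
  shows "tagged_part a b N t t" and "mesh N t = (b - a) / real N"
proof -
  have step: "t i - t (i - 1) = (b - a) / real N" if "i \<in> {1..N}" for i
    using that by (simp add: t_def of_nat_diff field_simps)
  then have "(\<lambda>i. t i - t (i - 1)) ` {1..N} = (\<lambda>i. (b - a) / real N) ` {1..N}"
    by (intro image_cong) auto
  also have "\<dots> = {(b - a) / real N}"
    using assms(2) by auto
  finally show "mesh N t = (b - a) / real N"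
    by (simp add: mesh_def)
  have "t (i - 1) < t i" if "i \<in> {1..N}" for i
    using step[OF that] assms(1,2)
    by (smt (verit) divide_pos_pos of_nat_0_less_iff less_le_trans zero_less_one)
  then show "tagged_part a b N t t"
    using assms(1,2) by (auto simp: tagged_part_def t_def less_imp_le)
qed

text \<open>Guarantees that the condition defining the integral is never vacuous on a nondegenerate
  interval. Without this, limits of Riemann sums could not be unique. Equidistant points tagged at
  right endpoints suffice.\<close>

lemma tagged_part_exists:
  fixes a b :: real
  assumes "a < b" and "\<delta> > 0"
  obtains N t s where "tagged_part a b N t s" and "mesh N t < \<delta>"
proof -
  obtain N :: nat where N: "(b - a) / \<delta> < real N"
    using reals_Archimedean2 by blast
  then have "real N > 0"
    using assms by (smt (verit) divide_pos_pos)
  then have "1 \<le> N" and "(b - a) / real N < \<delta>"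
    using N assms by (auto simp: field_simps)
  with uniform_tagged_part[OF assms(1)] that show ?thesis
    by metis
qed

text \<open>A single partition finer than both thresholds puts one Riemann sum within half of
  \<open>dist x y\<close> of both candidates. This justifies the definite description in
  \<open>riemann_integral\<close>.\<close>

lemma has_riemann_integral_unique:
  assumes x: "has_riemann_integral f a b x" and y: "has_riemann_integral f a b y"
  shows "x = y"
proof (cases "a < b")
  case True
  show ?thesis
  proof (rule ccontr)
    assume "x \<noteq> y"
    define \<epsilon> where "\<epsilon> = dist x y / 2"
    have "\<epsilon> > 0"
      using \<open>x \<noteq> y\<close> by (simp add: \<epsilon>_def)
    obtain \<delta>1 where d1: "\<delta>1 > 0" "\<And>N t s. tagged_part a b N t s \<Longrightarrow> mesh N t < \<delta>1 \<Longrightarrow>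
        dist (riemann_sum f N t s) x < \<epsilon>"
      using x True \<open>\<epsilon> > 0\<close> unfolding has_riemann_integral_def by (metis less_irrefl)
    obtain \<delta>2 where d2: "\<delta>2 > 0" "\<And>N t s. tagged_part a b N t s \<Longrightarrow> mesh N t < \<delta>2 \<Longrightarrow>
        dist (riemann_sum f N t s) y < \<epsilon>"
      using y True \<open>\<epsilon> > 0\<close> unfolding has_riemann_integral_def by (metis less_irrefl)
    obtain N t s where p: "tagged_part a b N t s" "mesh N t < min \<delta>1 \<delta>2"
      using tagged_part_exists[OF True, of "min \<delta>1 \<delta>2"] d1(1) d2(1) by auto
    have "dist (riemann_sum f N t s) x < \<epsilon>" "dist (riemann_sum f N t s) y < \<epsilon>"
      using d1(2) d2(2) p by auto
    then show False
      using dist_triangle3[of x y "riemann_sum f N t s"] by (simp add: \<epsilon>_def)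
  qed
qed (use x y in \<open>auto simp: has_riemann_integral_def\<close>)

lemma riemann_integral_unique:
  assumes "has_riemann_integral f a b x"
  shows "riemann_integral f a b = x"
  unfolding riemann_integral_def
  using assms by (blast intro: the_equality has_riemann_integral_unique)

lemma tagged_part_mono:
  assumes "tagged_part a b N t s" and "i \<le> j" and "j \<le> N"
  shows "t i \<le> t j"
  using assms(2,3)
proof (induction j rule: dec_induct)
  case (step j)
  then have "t j < t (Suc j)"
    using assms(1) unfolding tagged_part_def
    by (metis Suc_eq_plus1 add_diff_cancel_right' atLeastAtMost_iff le_add2)
  with step show ?case by simp
qed simp

text \<open>Telescoping, stated for general \<open>g\<close> because it serves twice: with
  \<open>F\<close> for the total increment and with the identity for the total length.\<close>

lemma tagged_part_sum_diff:
  fixes g :: "real \<Rightarrow> 'a::ab_group_add"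
  assumes "tagged_part a b N t s"
  shows "(\<Sum>i=1..N. g (t i) - g (t (i - 1))) = g b - g a"
proof -
  have "(\<Sum>i=1..N. g (t i) - g (t (i - 1))) = g (t N) - g (t 0)"
    by (induction N) auto
  with assms show ?thesis
    by (simp add: tagged_part_def)
qed

lemma tagged_part_step:
  assumes "tagged_part a b N t s" and "i \<in> {1..N}"
  shows "a \<le> t (i - 1)" and "t (i - 1) < t i" and "t i \<le> b"
    and "s i \<in> {t (i - 1)..t i}" and "t i - t (i - 1) \<le> mesh N t"
proof -
  show "a \<le> t (i - 1)" "t i \<le> b"
    using tagged_part_mono[OF assms(1), of 0 "i - 1"] tagged_part_mono[OF assms(1), of i N] assms
    by (auto simp: tagged_part_def)
  show "t (i - 1) < t i" "s i \<in> {t (i - 1)..t i}"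
    using assms by (auto simp: tagged_part_def)
  show "t i - t (i - 1) \<le> mesh N t"
    using assms(2) unfolding mesh_def by (intro Max_ge) auto
qed

section \<open>The distance to 0 as a norm, and the mean value inequality\<close>

context
  assumes invariant: "\<And>x y z :: 'a::{real_vector, metric_space}. dist (x + z) (y + z) = dist x y"
    and scaling: "\<And>(l::real) (x::'a) y.
      0 \<le> l \<Longrightarrow> l < 1 \<Longrightarrow> dist (l *\<^sub>R x) (l *\<^sub>R y) \<le> l * dist x y"
begin

lemma dist_conv_dist_0: "dist x y = dist 0 (y - x)" for x y :: 'a
  using invariant[of x "- x" y] by simp

lemma dist_0_uminus: "dist 0 (- x) = dist 0 x" for x :: 'a
  using dist_conv_dist_0[of x 0] by (simp add: dist_commute)

lemma dist_0_add_le: "dist 0 (x + y) \<le> dist 0 x + dist 0 y" for x y :: 'a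
  using dist_triangle[of 0 "x + y" x] dist_conv_dist_0[of x "x + y"] by simp

lemma dist_0_sum_le: "dist 0 (sum f A) \<le> (\<Sum>i\<in>A. dist 0 (f i))" for f :: "'b \<Rightarrow> 'a"
proof (induction A rule: infinite_finite_induct)
  case (insert i A)
  then show ?case
    using dist_0_add_le[of "f i" "sum f A"] by simp
qed simp_all

lemma dist_0_scaleR:
  fixes x :: 'a
  assumes "l \<ge> 0"
  shows "dist 0 (l *\<^sub>R x) = l * dist 0 x"
proof -
  \<comment> \<open>Strict positivity of \<open>m\<close> makes \<open>1 - m < 1\<close>, so the
    scaling hypothesis applies to both summands of
    \<open>y = m *\<^sub>R y + (1 - m) *\<^sub>R y\<close>.\<close>
  have unit: "dist 0 (m *\<^sub>R y) = m * dist 0 y" if "0 < m" "m < 1" for m and y :: 'a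
  proof (rule antisym)
    show "dist 0 (m *\<^sub>R y) \<le> m * dist 0 y"
      using scaling[of m 0 y] that by simp
    have "dist 0 y \<le> dist 0 (m *\<^sub>R y) + dist 0 ((1 - m) *\<^sub>R y)"
      using dist_0_add_le[of "m *\<^sub>R y" "(1 - m) *\<^sub>R y"] by (simp flip: scaleR_add_left)
    also have "dist 0 ((1 - m) *\<^sub>R y) \<le> (1 - m) * dist 0 y"
      using scaling[of "1 - m" 0 y] that by simp
    finally show "m * dist 0 y \<le> dist 0 (m *\<^sub>R y)"
      by (simp add: algebra_simps)
  qed
  consider "l = 0" | "l = 1" | "0 < l" "l < 1" | "l > 1"
    using assms by linarith
  then show ?thesis
  proof cases
    \<comment> \<open>A factor above 1 is undone by shrinking: \<open>x\<close> is
      \<open>1 / l\<close> times \<open>l *\<^sub>R x\<close>.\<close>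
    case 4
    then show ?thesis
      using unit[of "1 / l" "l *\<^sub>R x"] by (simp add: field_simps)
  qed (use unit in auto)
qed

text \<open>The estimate is additive over adjacent intervals and holds, up to a slack \<eta>, on
  short intervals around each point, so bisection makes it global. Subtracting the linear map with
  slope \<open>y\<close> prepares for \<open>y\<close> being the derivative at a tag. The set
  \<open>S\<close> lets derivatives relative to a larger interval be used on subintervals.\<close>

lemma mean_value_inequality:
  fixes F F' :: "real \<Rightarrow> 'a"
  assumes "c \<le> d" and "{c..d} \<subseteq> S"
    and deriv: "\<And>x. x \<in> {c..d} \<Longrightarrow> has_metric_derivative F (F' x) x S"
    and bound: "\<And>x. x \<in> {c..d} \<Longrightarrow> dist (F' x) y \<le> e"
  shows "dist 0 (F d - F c - (d - c) *\<^sub>R y) \<le> e * (d - c)"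
proof -
  have approx: "dist 0 (F d - F c - (d - c) *\<^sub>R y) \<le> (e + \<eta>) * (d - c)" if "\<eta> > 0" for \<eta>
  proof -
    \<comment> \<open>The guards make \<open>P\<close> vacuous for intervals leaving
      \<open>{c..d}\<close>, which the local condition in \<open>Bolzano\<close> also ranges over.
      The slack \<eta> absorbs the little-o remainder.\<close>
    define P where "P u v \<longleftrightarrow> c \<le> u \<longrightarrow> v \<le> d \<longrightarrow>
        dist 0 (F v - F u - (v - u) *\<^sub>R y) \<le> (e + \<eta>) * (v - u)" for u v
    have "P c d"
    proof (rule Bolzano[OF \<open>c \<le> d\<close>])
      fix u v w assume P: "P u v" "P v w" and "u \<le> v" "v \<le> w"
      have "F w - F u - (w - u) *\<^sub>R y = (F v - F u - (v - u) *\<^sub>R y) + (F w - F v - (w - v) *\<^sub>R y)"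
        by (simp add: algebra_simps)
      then have "dist 0 (F w - F u - (w - u) *\<^sub>R y)
          \<le> dist 0 (F v - F u - (v - u) *\<^sub>R y) + dist 0 (F w - F v - (w - v) *\<^sub>R y)"
        using dist_0_add_le by metis
      moreover have "(e + \<eta>) * (w - u) = (e + \<eta>) * (v - u) + (e + \<eta>) * (w - v)"
        by (simp add: algebra_simps)
      ultimately show "P u w"
        using P \<open>u \<le> v\<close> \<open>v \<le> w\<close> unfolding P_def by linarith
    next
      fix x assume "c \<le> x" "x \<le> d"
      then have x: "x \<in> {c..d}" by simp
      obtain r where "r > 0" and r: "\<And>v. v \<in> S \<Longrightarrow> \<bar>v - x\<bar> < r \<Longrightarrow>
          dist 0 (F v - F x - (v - x) *\<^sub>R F' x) \<le> \<eta> * \<bar>v - x\<bar>"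
        using has_metric_derivativeD[OF deriv[OF x] \<open>\<eta> > 0\<close>] by blast
      have "P u v" if uv: "u \<le> x" "x \<le> v" "v - u < r" for u v
        unfolding P_def
      proof (intro impI)
        assume "c \<le> u" "v \<le> d"
        then have "u \<in> S" "v \<in> S"
          using uv \<open>{c..d} \<subseteq> S\<close> by auto
        \<comment> \<open>The derivative at \<open>x\<close> controls only increments starting at
          \<open>x\<close>, so the increment is split there. Since \<open>u \<le> x \<le> v\<close>,
          the two remainders add up to at most \<open>\<eta> * (v - u)\<close>.\<close>
        have "F v - F u - (v - u) *\<^sub>R y = (F v - F x - (v - x) *\<^sub>R F' x)
            + (- (F u - F x - (u - x) *\<^sub>R F' x) + (v - u) *\<^sub>R (F' x - y))"
          by (simp add: algebra_simps)
        then have "dist 0 (F v - F u - (v - u) *\<^sub>R y)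
            \<le> dist 0 (F v - F x - (v - x) *\<^sub>R F' x)
              + (dist 0 (F u - F x - (u - x) *\<^sub>R F' x) + dist 0 ((v - u) *\<^sub>R (F' x - y)))"
          using dist_0_add_le dist_0_uminus by (smt (verit))
        also have "\<dots> \<le> \<eta> * (v - x) + (\<eta> * (x - u) + (v - u) * e)"
        proof (intro add_mono)
          show "dist 0 (F v - F x - (v - x) *\<^sub>R F' x) \<le> \<eta> * (v - x)"
            using r[OF \<open>v \<in> S\<close>] uv by simp
          show "dist 0 (F u - F x - (u - x) *\<^sub>R F' x) \<le> \<eta> * (x - u)"
            using r[OF \<open>u \<in> S\<close>] uv by simp
          have "dist 0 (F' x - y) \<le> e"
            using bound[OF x] dist_conv_dist_0[of y "F' x"] by (simp add: dist_commute)
          then show "dist 0 ((v - u) *\<^sub>R (F' x - y)) \<le> (v - u) * e"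
            using uv by (simp add: dist_0_scaleR mult_left_mono)
        qed
        also have "\<dots> = (e + \<eta>) * (v - u)"
          by (simp add: algebra_simps)
        finally show "dist 0 (F v - F u - (v - u) *\<^sub>R y) \<le> (e + \<eta>) * (v - u)" .
      qed
      with \<open>r > 0\<close> show "\<exists>r>0. \<forall>u v. u \<le> x \<and> x \<le> v \<and> v - u < r \<longrightarrow> P u v"
        by blast
    qed
    then show ?thesis
      by (simp add: P_def)
  qed
  show ?thesis
  \<comment> \<open>Letting \<eta> tend to 0 requires dividing by \<open>d - c\<close>; for
    \<open>c = d\<close> both sides are 0.\<close>
  proof (cases "c = d")
    case False
    show ?thesis
    proof (rule field_le_epsilon)
      fix \<epsilon> :: real assume "\<epsilon> > 0"
      then show "dist 0 (F d - F c - (d - c) *\<^sub>R y) \<le> e * (d - c) + \<epsilon>"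
        using approx[of "\<epsilon> / (d - c)"] False \<open>c \<le> d\<close> by (simp add: distrib_right)
    qed
  qed simp
qed

section \<open>Integration of a continuous derivative\<close>

lemma has_riemann_integral_derivative:
  fixes F F' :: "real \<Rightarrow> 'a"
  assumes "a \<le> \<tau>" and "{a..\<tau>} \<subseteq> S"
    and deriv: "\<And>x. x \<in> {a..\<tau>} \<Longrightarrow> has_metric_derivative F (F' x) x S"
    and cont: "continuous_on {a..\<tau>} F'"
  shows "has_riemann_integral F' a \<tau> (F \<tau> - F a)"
\<comment> \<open>For \<open>a = \<tau>\<close> the convention for degenerate intervals applies, as
  the increment of \<open>F\<close> is then 0.\<close>
proof (cases "a = \<tau>")
  case False
  with \<open>a \<le> \<tau>\<close> have "a < \<tau>" by simp
  have "\<exists>\<delta>>0. \<forall>N t s. tagged_part a \<tau> N t s \<longrightarrow> mesh N t < \<delta> \<longrightarrow>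
      dist (riemann_sum F' N t s) (F \<tau> - F a) < \<epsilon>" if "\<epsilon> > 0" for \<epsilon>
  proof -
    \<comment> \<open>Chosen so that the errors, at most \<open>e\<close> per unit length, total
      \<epsilon> / 2; the halving turns the non-strict estimates into a strict one.\<close>
    define e where "e = \<epsilon> / 2 / (\<tau> - a)"
    have "e > 0"
      using \<open>\<epsilon> > 0\<close> \<open>a < \<tau>\<close> by (simp add: e_def)
    have "uniformly_continuous_on {a..\<tau>} F'"
      using cont by (intro compact_uniformly_continuous) auto
    then obtain \<delta> where "\<delta> > 0" and \<delta>: "\<And>x y. x \<in> {a..\<tau>} \<Longrightarrow> y \<in> {a..\<tau>} \<Longrightarrow>
        dist x y < \<delta> \<Longrightarrow> dist (F' x) (F' y) < e"
      using \<open>e > 0\<close> unfolding uniformly_continuous_on_def by metis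
    have "dist (riemann_sum F' N t s) (F \<tau> - F a) < \<epsilon>"
      if part: "tagged_part a \<tau> N t s" and "mesh N t < \<delta>" for N t s
    proof -
      \<comment> \<open>On each subinterval the slope is the derivative at the tag. Every point
        there is within the mesh of the tag, so uniform continuity bounds the oscillation by
        \<open>e\<close>.\<close>
      have "dist 0 (F (t i) - F (t (i - 1)) - (t i - t (i - 1)) *\<^sub>R F' (s i))
          \<le> e * (t i - t (i - 1))" if "i \<in> {1..N}" for i
      proof (rule mean_value_inequality)
        note step = tagged_part_step[OF part that]
        have sub: "{t (i - 1)..t i} \<subseteq> {a..\<tau>}"
          using step by auto
        with \<open>{a..\<tau>} \<subseteq> S\<close> show "{t (i - 1)..t i} \<subseteq> S" by blast
        show "t (i - 1) \<le> t i"
          using step by simp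
        fix x assume x: "x \<in> {t (i - 1)..t i}"
        then show "has_metric_derivative F (F' x) x S"
          using deriv sub by blast
        have "dist x (s i) < \<delta>"
          using x step \<open>mesh N t < \<delta>\<close> by (auto simp: dist_real_def)
        then show "dist (F' x) (F' (s i)) \<le> e"
          using \<delta>[of x "s i"] x step(4) sub by (meson less_imp_le subsetD)
      qed
      then have "(\<Sum>i=1..N. dist 0 (F (t i) - F (t (i - 1)) - (t i - t (i - 1)) *\<^sub>R F' (s i)))
          \<le> (\<Sum>i=1..N. e * (t i - t (i - 1)))"
        by (rule sum_mono)
      also have "\<dots> = e * (\<tau> - a)"
        using tagged_part_sum_diff[OF part, of "\<lambda>x. x"] by (simp flip: sum_distrib_left)
      also have "\<dots> = \<epsilon> / 2"
        \<comment> \<open>The instantiated rule is the definition of \<open>e\<close> with the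
          denominator \<open>\<tau> - a\<close> cleared.\<close>
        using \<open>a < \<tau>\<close> nonzero_eq_divide_eq[THEN iffD1, OF _ e_def] by simp
      also have "\<dots> < \<epsilon>"
        using \<open>\<epsilon> > 0\<close> by simp
      finally have "(\<Sum>i=1..N. dist 0 (F (t i) - F (t (i - 1)) - (t i - t (i - 1)) *\<^sub>R F' (s i))) < \<epsilon>" .
      \<comment> \<open>By telescoping, the error of the Riemann sum is exactly the sum of the
        errors on the subintervals.\<close>
      moreover have "F \<tau> - F a - riemann_sum F' N t s
          = (\<Sum>i=1..N. F (t i) - F (t (i - 1)) - (t i - t (i - 1)) *\<^sub>R F' (s i))"
        using tagged_part_sum_diff[OF part, of F] by (simp add: riemann_sum_def sum_subtractf)
      ultimately show ?thesis
        using dist_0_sum_le[of "\<lambda>i. F (t i) - F (t (i - 1)) - (t i - t (i - 1)) *\<^sub>R F' (s i)" "{1..N}"]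
        by (simp add: dist_conv_dist_0[of "riemann_sum F' N t s"])
    qed
    with \<open>\<delta> > 0\<close> show ?thesis by blast
  qed
  with \<open>a < \<tau>\<close> show ?thesis
    by (auto simp: has_riemann_integral_def)
qed (simp add: has_riemann_integral_def)

end

theorem theorem2p2:
  fixes F F' :: "real \<Rightarrow> 'a::{real_vector, complete_space}"
    and a b :: real
  assumes invariant: "\<And>x y z :: 'a. dist (x + z) (y + z) = dist x y"
    and scaling: "\<And>(l::real) (x::'a) y.
          0 \<le> l \<Longrightarrow> l < 1 \<Longrightarrow> dist (l *\<^sub>R x) (l *\<^sub>R y) \<le> l * dist x y"
    and ab: "a < b"
    and deriv: "\<forall>t\<in>{a..b}. has_metric_derivative F (F' t) t {a..b}"
    and cont: "continuous_on {a..b} F'"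
  shows "\<forall>\<tau>\<in>{a..b}. riemann_integrable F' a \<tau> \<and>
           riemann_integral F' a \<tau> = F \<tau> - F a"
proof
  fix \<tau> assume "\<tau> \<in> {a..b}"
  then have sub: "a \<le> \<tau>" "{a..\<tau>} \<subseteq> {a..b}"
    by auto
  have "has_riemann_integral F' a \<tau> (F \<tau> - F a)"
  proof (rule has_riemann_integral_derivative[OF invariant scaling sub])
    show "has_metric_derivative F (F' x) x {a..b}" if "x \<in> {a..\<tau>}" for x
      using deriv sub that by blast
    show "continuous_on {a..\<tau>} F'"
      using cont sub(2) by (rule continuous_on_subset)
  qed
  \<comment> \<open>The increment of \<open>F\<close> witnesses integrability, and uniqueness
    identifies it with the value of the integral.\<close>
  then show "riemann_integrable F' a \<tau> \<and> riemann_integral F' a \<tau> = F \<tau> - F a"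
    by (auto simp: riemann_integrable_def riemann_integral_unique)
qed

end
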